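(* Let $\mathbb{F}$ be an arbitrary field, let $n, m, l, k$ be positive integers with $l > m+k+1$ and $l+k+1 \le n$. Let $\mathcal{B}_{k,m,l} \subseteq \mathrm{M}_n(\mathbb{F})$ be the subalgebra generated by the $n \times n$ identity matrix, the matrices $$B_1 = E_{m,m+1}+E_{m+1,m+2}+\cdots+E_{m+k,m+k+1},$$ $$B_2 = E_{l,l+1}+E_{l+1,l+2}+\cdots+E_{l+k,l+k+1},$$ and all matrix units $E_{i,j}$ for which ($1\le i\le m$ or $i=l$) and ($m+k+1\le j\le l-1$ or $l+k+1\le j\le n$). Then $\mathcal{B}_{k,m,l}$ is a maximal commutative subalgebra of $\mathrm{M}_n(\mathbb{F})$, and its length is $\ell(\mathcal{B}_{k,m,l}) = k+1$.
   Context: $\mathrm{M}_n(\mathbb{F})$ is the algebra of $n\times n$ matrices over $\mathbb{F}$, and $E_{i,j}$ is the matrix unit with $1$ in position $(i,j)$ and $0$ elsewhere. A commutative subalgebra $\mathcal{B}\subseteq \mathrm{M}_n(\mathbb{F})$ is called a maximal commutative subalgebra if there is no commutative subalgebra $\mathcal{B}'$ of $\mathrm{M}_n(\mathbb{F})$ with $\mathcal{B}\subsetneq\mathcal{B}'$. Length of an algebra: let $\mathcal{A}$ be a finite-dimensional associative algebra with identity $1$ over $\mathbb{F}$ and let $\mathcal{S}\subseteq\mathcal{A}$ be a finite subset. A word of length $t$ in $\mathcal{S}$ is a product $a_{1}\cdots a_{t}$ of $t$ elements of $\mathcal{S}$ (repetitions allowed); the identity $1$ is regarded as the (empty) word of length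 $0$. For $i\ge 0$, $L_i(\mathcal{S})$ denotes the $\mathbb{F}$-linear span of all words in $\mathcal{S}$ of length at most $i$ (so $L_0(\mathcal{S})=\mathbb{F}1$), and $L(\mathcal{S})=\bigcup_{i\ge 0}L_i(\mathcal{S})$. The set $\mathcal{S}$ is a generating system of $\mathcal{A}$ if $L(\mathcal{S})=\mathcal{A}$; its length $\ell(\mathcal{S})$ is then the minimal non-negative integer $r$ such that $L_r(\mathcal{S})=\mathcal{A}$. The length of $\mathcal{A}$ is $\ell(\mathcal{A})=\max\{\ell(\mathcal{S}) : \mathcal{S} \text{ a finite generating system of } \mathcal{A}\}$. *)

theory Defs
  imports "Jordan_Normal_Form.VS_Connect"
begin

text \<open>
  An algebra over a field \<open>K\<close> is represented by a \<open>module_scheme\<close> record \<open>A\<close>; the ring part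
  of the record carries the (possibly noncommutative) multiplication and the identity.  The full
  matrix algebra is \<open>module_mat TYPE('a) n n\<close> over \<open>class_ring\<close>, and a subalgebra \<open>B\<close> is turned
  into an algebra of its own by \<open>A\<lparr>carrier := B\<rparr>\<close>.
\<close>

subsection \<open>Subalgebras\<close>

text \<open>
  Subalgebras are not required to contain \<open>\<one>\<^bsub>A\<^esub>\<close>.  This makes no difference below: the identity
  is one of the generators of the subalgebra under consideration, hence it lies in all of its
  extensions as well.
\<close>

definition is_subalgebra ::
    "('a, 'c) ring_scheme \<Rightarrow> ('a, 'b, 'd) module_scheme \<Rightarrow> 'b set \<Rightarrow> bool" where
  "is_subalgebra K A B \<longleftrightarrow> submodule K B A \<and> (\<forall>x\<in>B. \<forall>y\<in>B. x \<otimes>\<^bsub>A\<^esub> y \<in> B)"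

definition generated_subalgebra ::
    "('a, 'c) ring_scheme \<Rightarrow> ('a, 'b, 'd) module_scheme \<Rightarrow> 'b set \<Rightarrow> 'b set" where
  "generated_subalgebra K A X = is_subalgebra K A hull X"

definition commutative_subalgebra ::
    "('a, 'c) ring_scheme \<Rightarrow> ('a, 'b, 'd) module_scheme \<Rightarrow> 'b set \<Rightarrow> bool" where
  "commutative_subalgebra K A B \<longleftrightarrow>
     is_subalgebra K A B \<and> (\<forall>x\<in>B. \<forall>y\<in>B. x \<otimes>\<^bsub>A\<^esub> y = y \<otimes>\<^bsub>A\<^esub> x)"

definition maximal_commutative_subalgebra ::
    "('a, 'c) ring_scheme \<Rightarrow> ('a, 'b, 'd) module_scheme \<Rightarrow> 'b set \<Rightarrow> bool" where
  "maximal_commutative_subalgebra K A B \<longleftrightarrow>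
     commutative_subalgebra K A B \<and> \<not> (\<exists>B'. commutative_subalgebra K A B' \<and> B \<subset> B')"

subsection \<open>Length of an algebra\<close>

definition word_product :: "('b, 'd) monoid_scheme \<Rightarrow> 'b list \<Rightarrow> 'b" where
  "word_product A ws = foldr (\<lambda>x y. x \<otimes>\<^bsub>A\<^esub> y) ws \<one>\<^bsub>A\<^esub>"

definition word_span ::
    "('a, 'c) ring_scheme \<Rightarrow> ('a, 'b, 'd) module_scheme \<Rightarrow> 'b set \<Rightarrow> nat \<Rightarrow> 'b set" where
  "word_span K A S i =
     LinearCombinations.module.span K A {word_product A ws | ws. set ws \<subseteq> S \<and> length ws \<le> i}"

definition generating_system ::
    "('a, 'c) ring_scheme \<Rightarrow> ('a, 'b, 'd) module_scheme \<Rightarrow> 'b set \<Rightarrow> bool" where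
  "generating_system K A S \<longleftrightarrow>
     finite S \<and> S \<subseteq> carrier A \<and> (\<Union>i. word_span K A S i) = carrier A"

definition system_length ::
    "('a, 'c) ring_scheme \<Rightarrow> ('a, 'b, 'd) module_scheme \<Rightarrow> 'b set \<Rightarrow> nat" where
  "system_length K A S = (LEAST r. word_span K A S r = carrier A)"

definition algebra_length ::
    "('a, 'c) ring_scheme \<Rightarrow> ('a, 'b, 'd) module_scheme \<Rightarrow> nat" where
  "algebra_length K A = Max {system_length K A S | S. generating_system K A S}"

subsection \<open>The subalgebras \<open>\<B>\<^bsub>k,m,l\<^esub>\<close>\<close>

text \<open>Rows and columns of the library's matrices are numbered from 0; here \<open>i\<close> and \<open>j\<close> are
  numbered from 1.\<close>

definition matrix_unit :: "nat \<Rightarrow> nat \<Rightarrow> nat \<Rightarrow> 'a::field mat" where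
  "matrix_unit n i j = mat n n (\<lambda>(r, c). if Suc r = i \<and> Suc c = j then 1 else 0)"

text \<open>\<open>E\<^bsub>s,s+1\<^esub> + E\<^bsub>s+1,s+2\<^esub> + \<dots> + E\<^bsub>s+k,s+k+1\<^esub>\<close>\<close>

definition shift_block :: "nat \<Rightarrow> nat \<Rightarrow> nat \<Rightarrow> 'a::field mat" where
  "shift_block n k s =
     (\<Oplus>\<^bsub>module_mat TYPE('a) n n\<^esub>i\<in>{s..s + k}. matrix_unit n i (i + 1))"

definition B_generators :: "nat \<Rightarrow> nat \<Rightarrow> nat \<Rightarrow> nat \<Rightarrow> 'a::field mat set" where
  "B_generators n k m l =
     {1\<^sub>m n, shift_block n k m, shift_block n k l} \<union>
     {matrix_unit n i j | i j.
        (1 \<le> i \<and> i \<le> m \<or> i = l) \<and>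
        (m + k + 1 \<le> j \<and> j \<le> l - 1 \<or> l + k + 1 \<le> j \<and> j \<le> n)}"

definition B_algebra :: "nat \<Rightarrow> nat \<Rightarrow> nat \<Rightarrow> nat \<Rightarrow> 'a::field mat set" where
  "B_algebra n k m l =
     generated_subalgebra class_ring (module_mat TYPE('a) n n) (B_generators n k m l)"

end

theory Submission
  imports Defs
begin

text \<open>The algebra \<open>B\<close> equals the centralizer of its generators, and every generated subalgebra
  that contains the centralizer of its commuting generators is maximal commutative.  Every element
  of \<open>B\<close> is a scalar plus an element of an ideal \<open>J\<close> with \<open>J\<^sup>k\<^sup>+\<^sup>2 = 0\<close>, so subtracting
  scalars from the generators shows that words of length \<open>k + 1\<close> suffice.  They are needed for the
  given generators without \<open>E\<^bsub>m,m+k+1\<^esub>\<close>, which then arises only as \<open>B\<^sub>1\<^sup>k\<^sup>+\<^sup>1\<close>.\<close>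

section \<open>Subalgebras of matrices and spans of words\<close>

text \<open>With \<open>p = m - 1\<close> and \<open>q = l - 1\<close>, read the generators other
  than the identity as arrows between indices: two disjoint paths \<open>p\<close>, ...,
  \<open>p + k + 1\<close> and \<open>q\<close>, ..., \<open>q + k + 1\<close>, and one arrow from
  every source to every sink. No arrow enters a source and none leaves a sink, so an arrow from
  source to sink cannot be continued, and the longest walks are the two paths with
  \<open>k + 1\<close> steps. This explains the exponent \<open>k + 2\<close>, and why distinct
  generators other than the identity multiply to 0. The elements of an arbitrary generating system
  are not single arrows, so the upper bound uses only where they can be nonzero: after subtraction
  of the constant diagonal, each factor moves strictly to the right along a walk. For the lower
  bound the shortcut from \<open>p\<close> to \<open>p + k + 1\<close> is removed. Arrows from
  \<open>p\<close> to other sinks are dead ends, so the path itself is then the only way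
  there.\<close>

lemma submodule_mat_iff:
  "submodule class_ring W (module_mat TYPE('a::field) n n) \<longleftrightarrow>
     W \<subseteq> carrier_mat n n \<and> (\<forall>x\<in>W. \<forall>y\<in>W. x + y \<in> W) \<and> 0\<^sub>m n n \<in> W \<and>
     (\<forall>c. \<forall>x\<in>W. c \<cdot>\<^sub>m x \<in> W)"
proof -
  interpret matrix_vs n n "TYPE('a)" .
  have "module class_ring (module_mat TYPE('a) n n)"
    by unfold_locales
  then show ?thesis
    by (auto simp: submodule_def matrix_vs_simps)
qed

lemma is_subalgebra_mat_iff:
  "is_subalgebra class_ring (module_mat TYPE('a::field) n n) W \<longleftrightarrow>
     W \<subseteq> carrier_mat n n \<and> (\<forall>x\<in>W. \<forall>y\<in>W. x + y \<in> W) \<and> 0\<^sub>m n n \<in> W \<and>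
     (\<forall>c. \<forall>x\<in>W. c \<cdot>\<^sub>m x \<in> W) \<and> (\<forall>x\<in>W. \<forall>y\<in>W. x * y \<in> W)"
  by (auto simp: is_subalgebra_def submodule_mat_iff module_mat_simps)

lemma is_subalgebra_matI:
  assumes "W \<subseteq> carrier_mat n n" and "0\<^sub>m n n \<in> W"
    and "\<And>x y. x \<in> W \<Longrightarrow> y \<in> W \<Longrightarrow> x + y \<in> W" and "\<And>c x. x \<in> W \<Longrightarrow> c \<cdot>\<^sub>m x \<in> W"
    and "\<And>x y. x \<in> W \<Longrightarrow> y \<in> W \<Longrightarrow> x * y \<in> W"
  shows "is_subalgebra class_ring (module_mat TYPE('a::field) n n) W"
  using assms by (simp add: is_subalgebra_mat_iff)

text \<open>The combination is given by its entries, so that \<open>centralizer_subset_alg\<close>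
  has its membership and its entries at hand together.\<close>

lemma submodule_mat_lincomb:
  assumes "submodule class_ring W (module_mat TYPE('a::field) n n)"
    and "finite A" and "\<And>a. a \<in> A \<Longrightarrow> M a \<in> W"
  shows "mat n n (\<lambda>(r, c). \<Sum>a\<in>A. f a * M a $$ (r, c)) \<in> W"
  using assms(2,3)
proof (induction A rule: finite_induct)
  case empty
  have "mat n n (\<lambda>(r, c). \<Sum>a\<in>{}. f a * M a $$ (r, c)) = 0\<^sub>m n n"
    by auto
  then show ?case
    using assms(1) by (simp only: submodule_mat_iff)
next
  case (insert a A)
  let ?Z = "mat n n (\<lambda>(r, c). \<Sum>a\<in>A. f a * M a $$ (r, c))"
  have "M a \<in> carrier_mat n n"
    using assms(1) insert.prems by (auto simp: submodule_mat_iff)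
  then have eq: "mat n n (\<lambda>(r, c). \<Sum>a\<in>insert a A. f a * M a $$ (r, c)) = f a \<cdot>\<^sub>m M a + ?Z"
    using insert.hyps by auto
  have add: "x + y \<in> W" if "x \<in> W" "y \<in> W" for x y
    using assms(1) that by (simp add: submodule_mat_iff)
  have "f a \<cdot>\<^sub>m M a \<in> W"
    using assms(1) insert.prems by (auto simp: submodule_mat_iff)
  moreover have "?Z \<in> W"
    using insert by blast
  ultimately show ?case
    unfolding eq by (rule add)
qed

lemma finsum_mat:
  assumes "finite A" and "\<And>a. a \<in> A \<Longrightarrow> f a \<in> carrier_mat n n"
  shows "(\<Oplus>\<^bsub>module_mat TYPE('a::field) n n\<^esub>a\<in>A. f a) = mat n n (\<lambda>(r, c). \<Sum>a\<in>A. f a $$ (r, c))"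
  using assms
proof (induction A rule: finite_induct)
  interpret matrix_vs n n "TYPE('a)" .
  case empty
  then show ?case
    by auto
next
  interpret matrix_vs n n "TYPE('a)" .
  case (insert a A)
  have "finsum (module_mat TYPE('a) n n) f (insert a A)
      = f a + finsum (module_mat TYPE('a) n n) f A"
    using insert by (intro M.finsum_insert) auto
  then show ?case
    using insert by auto
qed

section \<open>Centralizers and generated subalgebras\<close>

definition mat_centralizer :: "nat \<Rightarrow> 'a::field mat set \<Rightarrow> 'a mat set" where
  "mat_centralizer n G = {X \<in> carrier_mat n n. \<forall>g\<in>G. X * g = g * X}"

lemma is_subalgebra_mat_centralizer:
  assumes "G \<subseteq> carrier_mat n n"
  shows "is_subalgebra class_ring (module_mat TYPE('a::field) n n) (mat_centralizer n G)"
proof -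
  have "x * y * g = g * (x * y)"
    if "x \<in> mat_centralizer n G" "y \<in> mat_centralizer n G" "g \<in> G" for x y g
  proof -
    have c: "x \<in> carrier_mat n n" "y \<in> carrier_mat n n" "g \<in> carrier_mat n n"
      using that assms by (auto simp: mat_centralizer_def)
    have "x * y * g = x * (g * y)"
      using c that by (simp add: mat_centralizer_def)
    also have "\<dots> = (x * g) * y"
      using c by simp
    also have "\<dots> = (g * x) * y"
      using that by (simp add: mat_centralizer_def)
    finally show ?thesis
      using c by simp
  qed
  moreover have "(x + y) * g = g * (x + y)"
    if "x \<in> mat_centralizer n G" "y \<in> mat_centralizer n G" "g \<in> G" for x y g
    using that assms by (auto simp: mat_centralizer_def subset_iff add_mult_distrib_mat[of _ n n]
        mult_add_distrib_mat[of _ n n])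
  moreover have "(c \<cdot>\<^sub>m x) * g = g * (c \<cdot>\<^sub>m x)"
    if "x \<in> mat_centralizer n G" "g \<in> G" for x g c
    using that assms by (auto simp: mat_centralizer_def subset_iff mult_smult_assoc_mat[of _ n n]
        mult_smult_distrib[of _ n n])
  moreover have "0\<^sub>m n n * g = g * 0\<^sub>m n n" if "g \<in> G" for g
    using that assms by auto
  ultimately show ?thesis
    by (auto simp: is_subalgebra_mat_iff mat_centralizer_def)
qed

lemma is_subalgebra_generated:
  assumes "G \<subseteq> carrier_mat n n"
  shows "is_subalgebra class_ring (module_mat TYPE('a::field) n n)
           (generated_subalgebra class_ring (module_mat TYPE('a) n n) G)"
proof -
  let ?T = "{t. is_subalgebra class_ring (module_mat TYPE('a) n n) t \<and> G \<subseteq> t}"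
  \<comment> \<open>The hull is an intersection; without a member in the family it would be
    \<open>UNIV\<close> and leave the carrier.\<close>
  have full: "carrier_mat n n \<in> ?T"
    using assms by (auto simp: is_subalgebra_mat_iff)
  have closed: "x + y \<in> t" "x * y \<in> t" "c \<cdot>\<^sub>m x \<in> t"
    if "is_subalgebra class_ring (module_mat TYPE('a) n n) t" "x \<in> t" "y \<in> t" for t x y c
    using that by (simp_all add: is_subalgebra_mat_iff)
  have zero: "0\<^sub>m n n \<in> t" if "t \<in> ?T" for t
    using that by (simp add: is_subalgebra_mat_iff)
  show ?thesis
    unfolding generated_subalgebra_def hull_def
  proof (rule is_subalgebra_matI, goal_cases)
    case 1
    show ?case
      using full by (rule Inter_lower)
  next
    case 2
    show ?case
      using zero by (rule InterI)
  qed (rule InterI; drule (1) InterD; (drule (1) InterD)?; simp add: closed)+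
qed

text \<open>Minimality of the hull is used twice: the hull lies in the centralizer of
  \<open>G\<close>; hence \<open>G\<close> lies in the centralizer of the hull, which is again a
  subalgebra and so contains the hull.\<close>

lemma generated_subalgebra_commutes:
  assumes "G \<subseteq> mat_centralizer n G"
    and "x \<in> generated_subalgebra class_ring (module_mat TYPE('a::field) n n) G"
    and "y \<in> generated_subalgebra class_ring (module_mat TYPE('a) n n) G"
  shows "x * y = y * x"
proof -
  let ?H = "generated_subalgebra class_ring (module_mat TYPE('a) n n) G"
  have G: "G \<subseteq> carrier_mat n n"
    using assms(1) by (auto simp: mat_centralizer_def)
  have "?H \<subseteq> mat_centralizer n G"
    unfolding generated_subalgebra_def
    by (intro hull_minimal assms(1) is_subalgebra_mat_centralizer G)
  then have H: "?H \<subseteq> carrier_mat n n" and "G \<subseteq> mat_centralizer n ?H"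
    using G by (auto simp: mat_centralizer_def)
  then have "?H \<subseteq> mat_centralizer n ?H"
    unfolding generated_subalgebra_def
    by (intro hull_minimal) (auto intro: is_subalgebra_mat_centralizer)
  then show ?thesis
    using assms(2,3) by (auto simp: mat_centralizer_def)
qed

text \<open>A commutative algebra above the hull contains \<open>G\<close>, so its elements
  centralize \<open>G\<close> and fall back into the hull.\<close>

lemma maximal_commutative_subalgebraI:
  assumes "G \<subseteq> mat_centralizer n G"
    and "mat_centralizer n G \<subseteq> generated_subalgebra class_ring (module_mat TYPE('a::field) n n) G"
  shows "maximal_commutative_subalgebra class_ring (module_mat TYPE('a) n n)
           (generated_subalgebra class_ring (module_mat TYPE('a) n n) G)"
proof -
  let ?H = "generated_subalgebra class_ring (module_mat TYPE('a) n n) G"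
  have G: "G \<subseteq> carrier_mat n n"
    using assms(1) by (auto simp: mat_centralizer_def)
  have "commutative_subalgebra class_ring (module_mat TYPE('a) n n) ?H"
    using generated_subalgebra_commutes[OF assms(1)] is_subalgebra_generated[OF G]
    by (auto simp: commutative_subalgebra_def module_mat_simps)
  moreover have "B' \<subseteq> ?H"
    if "commutative_subalgebra class_ring (module_mat TYPE('a) n n) B'" "?H \<subseteq> B'" for B'
  proof -
    have "G \<subseteq> B'"
      using that(2) hull_subset unfolding generated_subalgebra_def by fast
    then have "B' \<subseteq> mat_centralizer n G"
      using that(1)
      by (auto simp: commutative_subalgebra_def module_mat_simps mat_centralizer_def
          is_subalgebra_mat_iff)
    then show ?thesis
      using assms(2) by blast
  qed
  ultimately show ?thesis
    by (auto simp: maximal_commutative_subalgebra_def)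
qed

section \<open>Words and the spaces they span\<close>

lemma foldr_mult_mat_closed:
  assumes "is_subalgebra class_ring (module_mat TYPE('a::field) n n) B"
    and "1\<^sub>m n \<in> B" and "set ws \<subseteq> B"
  shows "foldr (*) ws (1\<^sub>m n) \<in> B"
  using assms(3) by (induction ws) (use assms in \<open>auto simp: is_subalgebra_mat_iff\<close>)

lemma foldr_mult_mat_carrier:
  "set ws \<subseteq> carrier_mat n n \<Longrightarrow> foldr (*) ws (1\<^sub>m n) \<in> carrier_mat n n"
  by (induction ws) auto

lemma foldr_mult_mat_append:
  "set (us :: 'a::semiring_1 mat list) \<subseteq> carrier_mat n n \<Longrightarrow> set ws \<subseteq> carrier_mat n n \<Longrightarrow>
    foldr (*) (us @ ws) (1\<^sub>m n) = foldr (*) us (1\<^sub>m n) * foldr (*) ws (1\<^sub>m n)"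
proof (induction us)
  case Nil
  then show ?case
    using left_mult_one_mat[OF foldr_mult_mat_carrier, of ws] by simp
next
  case (Cons u us)
  then show ?case
    using foldr_mult_mat_carrier[of ws n] foldr_mult_mat_carrier[of us n]
    by (simp add: assoc_mult_mat[of _ n n _ n _ n])
qed

abbreviation mat_word_span :: "nat \<Rightarrow> 'a::field mat set \<Rightarrow> nat \<Rightarrow> 'a mat set" where
  "mat_word_span n \<equiv> word_span class_ring (module_mat TYPE('a) n n)"

lemma mat_word_span_eq:
  "mat_word_span n S i = LinearCombinations.module.span class_ring (module_mat TYPE('a::field) n n)
     {foldr (*) ws (1\<^sub>m n) | ws. set ws \<subseteq> S \<and> length ws \<le> i}"
  by (simp add: word_span_def word_product_def module_mat_simps)

text \<open>Moves all length computations into the full matrix module: shrinking the carrier keeps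
  products and scalars, and spans of subsets of a submodule agree in both modules.\<close>

lemma word_span_subalgebra:
  assumes "is_subalgebra class_ring (module_mat TYPE('a::field) n n) B"
    and "1\<^sub>m n \<in> B" and "S \<subseteq> B"
  shows "word_span class_ring ((module_mat TYPE('a) n n)\<lparr>carrier := B\<rparr>) S i = mat_word_span n S i"
proof -
  interpret matrix_vs n n "TYPE('a)" .
  have "{foldr (*) ws (1\<^sub>m n) | ws. set ws \<subseteq> S \<and> length ws \<le> i} \<subseteq> B"
    using foldr_mult_mat_closed[OF assms(1,2)] assms(3) by blast
  moreover have "submodule class_ring B (module_mat TYPE('a) n n)"
    using assms(1) by (simp add: is_subalgebra_def)
  ultimately show ?thesis
    using span_li_not_depend(1)[of _ B]
    by (simp add: word_span_def word_product_def module_mat_simps)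
qed

lemma submodule_mat_word_span:
  assumes "S \<subseteq> carrier_mat n n"
  shows "submodule class_ring (mat_word_span n S i) (module_mat TYPE('a::field) n n)"
proof -
  interpret matrix_vs n n "TYPE('a)" .
  show ?thesis
    unfolding mat_word_span_eq
    using foldr_mult_mat_carrier[of _ n] assms by (intro span_is_submodule) blast
qed

lemma mat_word_span_word:
  assumes "S \<subseteq> carrier_mat n n" and "set ws \<subseteq> S" and "length ws \<le> i"
  shows "foldr (*) ws (1\<^sub>m n) \<in> mat_word_span n (S :: 'a::field mat set) i"
proof -
  interpret matrix_vs n n "TYPE('a)" .
  have "{foldr (*) ws (1\<^sub>m n) | ws. set ws \<subseteq> S \<and> length ws \<le> i} \<subseteq> carrier_mat n n"
    using foldr_mult_mat_carrier[of _ n] assms by blast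
  from in_own_span[OF this] show ?thesis
    unfolding mat_word_span_eq using assms by blast
qed

lemma mat_word_span_minimal:
  assumes "submodule class_ring W (module_mat TYPE('a::field) n n)"
    and "\<And>ws. set ws \<subseteq> S \<Longrightarrow> length ws \<le> i \<Longrightarrow> foldr (*) ws (1\<^sub>m n) \<in> W"
  shows "mat_word_span n S i \<subseteq> W"
proof -
  interpret matrix_vs n n "TYPE('a)" .
  show ?thesis
    unfolding mat_word_span_eq by (rule span_is_subset) (use assms in blast)+
qed

lemma mat_word_span_mono:
  assumes "S \<subseteq> carrier_mat n n" and "i \<le> j"
  shows "mat_word_span n S i \<subseteq> mat_word_span n (S :: 'a::field mat set) j"
  using assms
  by (intro mat_word_span_minimal submodule_mat_word_span) (auto intro: mat_word_span_word)

lemma one_in_mat_word_span: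
  assumes "S \<subseteq> carrier_mat n n"
  shows "1\<^sub>m n \<in> mat_word_span n (S :: 'a::field mat set) i"
  using mat_word_span_word[OF assms, of "[]"] by simp

lemma generator_in_mat_word_span:
  assumes "S \<subseteq> carrier_mat n n" and "a \<in> S" and "0 < i"
  shows "a \<in> mat_word_span n (S :: 'a::field mat set) i"
proof -
  have "a * 1\<^sub>m n = a"
    using assms by auto
  then show ?thesis
    using mat_word_span_word[OF assms(1), of "[a]" i] assms by simp
qed

text \<open>Linearity of the product in each factor, in the form that
  \<open>mat_word_span_minimal\<close> needs: products of span elements are then tested on words,
  one factor at a time.\<close>

lemma submodule_mult_preimage:
  assumes "submodule class_ring W (module_mat TYPE('a::field) n n)"
    and "x \<in> carrier_mat n n"
  shows "submodule class_ring {y \<in> carrier_mat n n. x * y \<in> W} (module_mat TYPE('a) n n)"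
    and "submodule class_ring {y \<in> carrier_mat n n. y * x \<in> W} (module_mat TYPE('a) n n)"
  using assms
  by (auto simp: submodule_mat_iff mult_add_distrib_mat[of _ n n] add_mult_distrib_mat[of _ n n]
      mult_smult_assoc_mat[of _ n n] mult_smult_distrib[of _ n n])

lemma mat_word_span_mult:
  fixes S :: "'a::field mat set"
  assumes S: "S \<subseteq> carrier_mat n n"
    and x: "x \<in> mat_word_span n S i" and y: "y \<in> mat_word_span n S j"
  shows "x * y \<in> mat_word_span n S (i + j)"
proof -
  note sub = submodule_mat_word_span[OF S]
  have car: "z \<in> carrier_mat n n" if "z \<in> mat_word_span n S t" for z t
    using sub[of t] that by (auto simp: submodule_mat_iff)
  have words: "set ws \<subseteq> carrier_mat n n" if "set ws \<subseteq> S" for ws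
    using that S by blast
  have word: "foldr (*) us (1\<^sub>m n) * y \<in> mat_word_span n S (i + j)"
    if us: "set us \<subseteq> S" "length us \<le> i" for us
  proof -
    have "mat_word_span n S j
        \<subseteq> {y \<in> carrier_mat n n. foldr (*) us (1\<^sub>m n) * y \<in> mat_word_span n S (i + j)}"
    proof (rule mat_word_span_minimal[OF submodule_mult_preimage(1)[OF sub]], goal_cases)
      case 1
      show ?case
        by (rule foldr_mult_mat_carrier) (use us words in blast)
    next
      case (2 ws)
      have "foldr (*) us (1\<^sub>m n) * foldr (*) ws (1\<^sub>m n) = foldr (*) (us @ ws) (1\<^sub>m n)"
        using words[OF us(1)] words[OF 2(1)] by (simp only: foldr_mult_mat_append)
      moreover have "foldr (*) (us @ ws) (1\<^sub>m n) \<in> mat_word_span n S (i + j)"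
        using us 2 S by (intro mat_word_span_word) auto
      ultimately show ?case
        using foldr_mult_mat_carrier[OF words[OF 2(1)]] by simp
    qed
    then show ?thesis
      using y by blast
  qed
  have "mat_word_span n S i \<subseteq> {x \<in> carrier_mat n n. x * y \<in> mat_word_span n S (i + j)}"
  proof (rule mat_word_span_minimal[OF submodule_mult_preimage(2)[OF sub car[OF y]]])
    fix us assume us: "set us \<subseteq> S" "length us \<le> i"
    then show "foldr (*) us (1\<^sub>m n) \<in> {x \<in> carrier_mat n n. x * y \<in> mat_word_span n S (i + j)}"
      using foldr_mult_mat_carrier[OF words[OF us(1)]] word[OF us] by simp
  qed
  then show ?thesis
    using x by blast
qed

lemma is_subalgebra_Union_word_span:
  assumes "S \<subseteq> carrier_mat n n"
  shows "is_subalgebra class_ring (module_mat TYPE('a::field) n n) (\<Union>i. mat_word_span n S i)"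
proof -
  let ?L = "mat_word_span n S"
  note sub = submodule_mat_word_span[OF assms, unfolded submodule_mat_iff]
  have "x + y \<in> ?L (max i j)" if "x \<in> ?L i" "y \<in> ?L j" for x y i j
  proof -
    have "x \<in> ?L (max i j)" "y \<in> ?L (max i j)"
      using that mat_word_span_mono[OF assms, of i "max i j"]
        mat_word_span_mono[OF assms, of j "max i j"] by auto
    then show ?thesis
      using sub[of "max i j"] by blast
  qed
  note add = this
  show ?thesis
  proof (rule is_subalgebra_matI, goal_cases)
    case 1
    show ?case
      using sub by (intro UN_least) blast
  next
    case 2
    show ?case
      using sub by (intro UN_I[of 0]) blast+
  next
    case (3 x y)
    then show ?case
      using add by blast
  next
    case (4 c x)
    then obtain i where "x \<in> ?L i"
      by blast
    then show ?case
      using sub[of i] by (intro UN_I[of i]) auto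
  next
    case (5 x y)
    then show ?case
      using mat_word_span_mult[OF assms] by blast
  qed
qed

text \<open>Expanding the vanishing product of \<open>r + 1\<close> factors \<open>a - \<lambda>\<close> writes every word of length
  \<open>r + 1\<close> in terms of shorter words.  The filtration \<open>D\<close> records how many such factors have been
  split off from the left.\<close>

lemma word_span_bounded_by_filtration:
  fixes S :: "'a::field mat set"
  assumes S: "S \<subseteq> carrier_mat n n"
    and one: "1\<^sub>m n \<in> D 0"
    and carrier: "\<And>t. D t \<subseteq> carrier_mat n n"
    and step: "\<And>a. a \<in> S \<Longrightarrow> \<exists>x. \<forall>t. \<forall>p\<in>D t. p * (a - x \<cdot>\<^sub>m 1\<^sub>m n) \<in> D (Suc t)"
    and zero: "D (Suc r) \<subseteq> {0\<^sub>m n n}"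
  shows "mat_word_span n S i \<subseteq> mat_word_span n S r"
proof -
  let ?L = "mat_word_span n S"
  note sub = submodule_mat_word_span[OF S, unfolded submodule_mat_iff]
  have words: "set ws \<subseteq> carrier_mat n n" if "set ws \<subseteq> S" for ws
    using that S by blast
  \<comment> \<open>The prefix \<open>p\<close> stands for \<open>t\<close> factors already split
    off. With \<open>a = ?b + x\<close>, the scalar part drops a letter and keeps \<open>p\<close>,
    while \<open>?b\<close> is absorbed into \<open>p\<close> and raises \<open>t\<close>.
    Membership in \<open>D t\<close> makes \<open>p * ?b\<close> vanish at \<open>t = r\<close>;
    membership in \<open>?L t\<close> puts \<open>p\<close> into \<open>?L r\<close> once no letters
    remain. The length of \<open>ws\<close> is not bounded.\<close>
  have claim: "p * foldr (*) ws (1\<^sub>m n) \<in> ?L r"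
    if "p \<in> D t" "p \<in> ?L t" "t \<le> r" "set ws \<subseteq> S" for p t ws
    using that
  proof (induction ws arbitrary: p t)
    case Nil
    then have "p \<in> ?L r" "p \<in> carrier_mat n n"
      using mat_word_span_mono[OF S, of t r] carrier by auto
    then show ?case
      by simp
  next
    case (Cons a ws)
    then have a: "a \<in> S"
      by simp
    from step[OF a] obtain x where x: "\<And>t p. p \<in> D t \<Longrightarrow> p * (a - x \<cdot>\<^sub>m 1\<^sub>m n) \<in> D (Suc t)"
      by blast
    let ?w = "foldr (*) ws (1\<^sub>m n)" and ?b = "a - x \<cdot>\<^sub>m 1\<^sub>m n"
    have car: "p \<in> carrier_mat n n" "a \<in> carrier_mat n n" "?w \<in> carrier_mat n n"
        "?b \<in> carrier_mat n n"
      using Cons.prems S carrier foldr_mult_mat_carrier[OF words, of ws] by auto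
    have "a = ?b + x \<cdot>\<^sub>m 1\<^sub>m n"
      using car by auto
    then have "a * ?w = ?b * ?w + (x \<cdot>\<^sub>m 1\<^sub>m n) * ?w"
      using car by (metis add_mult_distrib_mat one_carrier_mat smult_carrier_mat)
    also have "(x \<cdot>\<^sub>m 1\<^sub>m n) * ?w = x \<cdot>\<^sub>m ?w"
      using car by (simp add: mult_smult_assoc_mat[of _ n n])
    finally have eq: "p * (a * ?w) = (p * ?b) * ?w + x \<cdot>\<^sub>m (p * ?w)"
      using car mult_add_distrib_mat[of p n n "?b * ?w" n "x \<cdot>\<^sub>m ?w"]
        assoc_mult_mat[of p n n ?b n ?w n] mult_smult_distrib[of p n n ?w n x]
      by (simp del: assoc_mult_mat)
    have "p * ?w \<in> ?L r"
      using Cons by auto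
    moreover have "(p * ?b) * ?w \<in> ?L r"
    proof (cases "t = r")
      case True
      then have "p * ?b = 0\<^sub>m n n"
        using x[OF Cons.prems(1)] zero by auto
      then show ?thesis
        using sub[of r] car by simp
    next
      case False
      have b: "?b = a + (- x) \<cdot>\<^sub>m 1\<^sub>m n"
        using car by auto
      have "(- x) \<cdot>\<^sub>m 1\<^sub>m n \<in> ?L 1" "a \<in> ?L 1"
        using sub[of 1] one_in_mat_word_span[OF S] generator_in_mat_word_span[OF S a] by auto
      then have "?b \<in> ?L 1"
        unfolding b using sub[of 1] by blast
      then have "p * ?b \<in> ?L (Suc t)"
        using mat_word_span_mult[OF S Cons.prems(2)] by fastforce
      then show ?thesis
        using Cons.IH[OF x[OF Cons.prems(1)]] Cons.prems False by auto
    qed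
    ultimately show ?case
      using eq sub[of r] by auto
  qed
  show ?thesis
  proof (intro mat_word_span_minimal submodule_mat_word_span S)
    fix ws assume ws: "set ws \<subseteq> S"
    then show "foldr (*) ws (1\<^sub>m n) \<in> ?L r"
      using claim[OF one one_in_mat_word_span[OF S] _ ws] foldr_mult_mat_carrier[OF words[OF ws]]
      by simp
  qed
qed

section \<open>Shifts and matrix units\<close>

text \<open>Shifts and matrix units have at most one nonzero entry in each row and column.
  \<open>P\<close> tells whether row \<open>r\<close> of \<open>Y\<close> has one and
  \<open>j\<close> where, so the product only copies an entry of \<open>X\<close>.\<close>

lemma index_mult_single_row:
  fixes X :: "'a::semiring_1 mat"
  assumes "X \<in> carrier_mat n n" "r < n" "c < n" and "Y \<in> carrier_mat n n"
    and "\<And>i. i < n \<Longrightarrow> Y $$ (r, i) = (if P \<and> i = j then 1 else 0)" and "P \<Longrightarrow> j < n"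
  shows "(Y * X) $$ (r, c) = (if P then X $$ (j, c) else 0)"
proof -
  have "(Y * X) $$ (r, c) = (\<Sum>i = 0..<n. Y $$ (r, i) * X $$ (i, c))"
    using assms by (simp add: scalar_prod_def)
  also have "\<dots> = (\<Sum>i = 0..<n. if i = j then (if P then X $$ (j, c) else 0) else 0)"
    using assms(5) by (intro sum.cong) auto
  also have "\<dots> = (if P then X $$ (j, c) else 0)"
    using assms(6) by (auto simp: sum.delta)
  finally show ?thesis .
qed

lemma index_mult_single_col:
  fixes X :: "'a::semiring_1 mat"
  assumes "X \<in> carrier_mat n n" "r < n" "c < n" and "Y \<in> carrier_mat n n"
    and "\<And>i. i < n \<Longrightarrow> Y $$ (i, c) = (if P \<and> i = j then 1 else 0)" and "P \<Longrightarrow> j < n"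
  shows "(X * Y) $$ (r, c) = (if P then X $$ (r, j) else 0)"
proof -
  have "(X * Y) $$ (r, c) = (\<Sum>i = 0..<n. X $$ (r, i) * Y $$ (i, c))"
    using assms by (simp add: scalar_prod_def)
  also have "\<dots> = (\<Sum>i = 0..<n. if i = j then (if P then X $$ (r, j) else 0) else 0)"
    using assms(5) by (intro sum.cong) auto
  also have "\<dots> = (if P then X $$ (r, j) else 0)"
    using assms(6) by (auto simp: sum.delta)
  finally show ?thesis .
qed

lemma matrix_unit_carrier [simp]:
  "matrix_unit n i j \<in> carrier_mat n n"
  "dim_row (matrix_unit n i j) = n" "dim_col (matrix_unit n i j) = n"
  by (simp_all add: matrix_unit_def)

lemma index_matrix_unit_mult:
  assumes "X \<in> carrier_mat n n" "r < n" "c < n" "j < n"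
  shows "(matrix_unit n (Suc i) (Suc j) * X) $$ (r, c) = (if r = i then X $$ (j, c) else 0)"
  using assms by (intro index_mult_single_row) (auto simp: matrix_unit_def)

lemma index_mult_matrix_unit:
  assumes "X \<in> carrier_mat n n" "r < n" "c < n" "i < n"
  shows "(X * matrix_unit n (Suc i) (Suc j)) $$ (r, c) = (if c = j then X $$ (r, i) else 0)"
  using assms by (intro index_mult_single_col) (auto simp: matrix_unit_def)

text \<open>The \<open>a\<close>-th power of \<open>shift_block n k (Suc s)\<close>, for \<open>a > 0\<close>.\<close>

definition shift_power :: "nat \<Rightarrow> nat \<Rightarrow> nat \<Rightarrow> nat \<Rightarrow> 'a::field mat" where
  "shift_power n k s a =
     mat n n (\<lambda>(r, c). if s \<le> r \<and> c \<le> s + k + 1 \<and> c = r + a then 1 else 0)"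

lemma shift_power_carrier [simp]:
  "shift_power n k s a \<in> carrier_mat n n"
  "dim_row (shift_power n k s a) = n" "dim_col (shift_power n k s a) = n"
  by (simp_all add: shift_power_def)

lemma index_shift_power:
  "r < n \<Longrightarrow> c < n \<Longrightarrow> shift_power n k s a $$ (r, c) =
     (if s \<le> r \<and> c \<le> s + k + 1 \<and> c = r + a then 1 else 0)"
  by (simp add: shift_power_def)

lemma shift_block_Suc: "shift_block n k (Suc s) = (shift_power n k s (Suc 0) :: 'a::field mat)"
proof -
  have "(\<Sum>i = Suc s..Suc s + k. matrix_unit n i (i + 1) $$ (r, c))
      = (shift_power n k s (Suc 0) $$ (r, c) :: 'a)" if "r < n" "c < n" for r c
  proof -
    have "(\<Sum>i = Suc s..Suc s + k. matrix_unit n i (i + 1) $$ (r, c))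
        = (\<Sum>i = Suc s..Suc s + k. if i = Suc r then (if c = Suc r then 1 else 0) else 0 :: 'a)"
      using that by (intro sum.cong) (auto simp: matrix_unit_def)
    also have "\<dots> = (shift_power n k s (Suc 0) $$ (r, c) :: 'a)"
      using that by (subst sum.delta) (auto simp: index_shift_power)
    finally show ?thesis .
  qed
  then have "mat n n (\<lambda>(r, c). \<Sum>i = Suc s..Suc s + k. matrix_unit n i (i + 1) $$ (r, c))
      = (shift_power n k s (Suc 0) :: 'a mat)"
    by (intro eq_matI) (auto simp del: sum.cl_ivl_Suc)
  then show ?thesis
    unfolding shift_block_def by (subst finsum_mat) auto
qed

text \<open>\<open>s + k + 1 < n\<close> keeps the row \<open>Suc r\<close> that is read inside the
  matrix.\<close>

lemma index_shift_mult:
  assumes "X \<in> carrier_mat n n" "r < n" "c < n" "s + k + 1 < n"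
  shows "(shift_power n k s (Suc 0) * X) $$ (r, c) = (if s \<le> r \<and> r \<le> s + k then X $$ (Suc r, c) else 0)"
  using assms by (intro index_mult_single_row) (auto simp: index_shift_power)

lemma index_mult_shift:
  assumes "X \<in> carrier_mat n n" "r < n" "c < n"
  shows "(X * shift_power n k s (Suc 0)) $$ (r, c) =
     (if s < c \<and> c \<le> s + k + 1 then X $$ (r, c - 1) else 0)"
  using assms by (intro index_mult_single_col) (auto simp: index_shift_power)

lemma shift_power_Suc:
  assumes "s + k + 1 < n" and "0 < a"
  shows "shift_power n k s (Suc a) = shift_power n k s (Suc 0) * shift_power n k s a"
  using assms by (intro eq_matI) (auto simp: index_shift_mult index_shift_power
      simp del: index_mult_mat(1))

section \<open>The algebra \<open>\<B>\<close>\<close>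

text \<open>In terms of the paper \<open>p = m - 1\<close> and \<open>q = l - 1\<close>, so that rows and columns are numbered
  from 0.\<close>

locale two_shifts =
  fixes n k p q :: nat and ty :: "'a::field itself"
  assumes pq: "p + k + 1 < q" and qn: "q + k + 1 < n" and k_pos: "0 < k"
begin

text \<open>The sources: rows of the matrix units among the generators, including the first index of
  each path. The sinks \<open>snk\<close> are their columns and include the last index of each path;
  the indices in between are the interior of \<open>interior_cases\<close>.\<close>

definition src :: "nat \<Rightarrow> bool" where
  "src r \<longleftrightarrow> r \<le> p \<or> r = q"

definition snk :: "nat \<Rightarrow> bool" where
  "snk c \<longleftrightarrow> p + k + 1 \<le> c \<and> c < q \<or> q + k + 1 \<le> c \<and> c < n"

abbreviation gens :: "'a mat set" where
  "gens \<equiv> B_generators n k (Suc p) (Suc q)"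

abbreviation alg :: "'a mat set" where
  "alg \<equiv> B_algebra n k (Suc p) (Suc q)"

lemma gens_eq:
  "gens = {1\<^sub>m n, shift_power n k p (Suc 0), shift_power n k q (Suc 0)} \<union>
     {matrix_unit n (Suc i) (Suc j) | i j. src i \<and> snk j}"
proof -
  have "{matrix_unit n i j | i j. (1 \<le> i \<and> i \<le> Suc p \<or> i = Suc q) \<and>
      (Suc p + k + 1 \<le> j \<and> j \<le> Suc q - 1 \<or> Suc q + k + 1 \<le> j \<and> j \<le> n)} =
    {matrix_unit n (Suc i) (Suc j) :: 'a mat | i j. src i \<and> snk j}" (is "?A = ?B")
  proof
    show "?A \<subseteq> ?B"
    proof
      fix X assume "X \<in> ?A"
      then obtain i j where ij: "X = matrix_unit n i j" "1 \<le> i \<and> i \<le> Suc p \<or> i = Suc q"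
          "Suc p + k + 1 \<le> j \<and> j \<le> Suc q - 1 \<or> Suc q + k + 1 \<le> j \<and> j \<le> n"
        by blast
      then have "X = matrix_unit n (Suc (i - 1)) (Suc (j - 1))" "src (i - 1)" "snk (j - 1)"
        using pq qn by (auto simp: src_def snk_def)
      then show "X \<in> ?B"
        by blast
    qed
    show "?B \<subseteq> ?A"
      by (force simp: src_def snk_def)
  qed
  then show ?thesis
    unfolding B_generators_def shift_block_Suc by simp
qed

lemma srcD: "src r \<Longrightarrow> r < n"
  using pq qn by (auto simp: src_def)

lemma snkD: "snk r \<Longrightarrow> r < n"
  using pq qn by (auto simp: snk_def)

lemma gens_cases [consumes 1, case_names one shift unit]:
  assumes "X \<in> gens"
  obtains "X = 1\<^sub>m n"
    | s where "s = p \<or> s = q" "X = shift_power n k s (Suc 0)"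
    | i j where "src i" "snk j" "X = matrix_unit n (Suc i) (Suc j)"
  using assms unfolding gens_eq by blast

lemma shift_in_gens: "s = p \<or> s = q \<Longrightarrow> shift_power n k s (Suc 0) \<in> gens"
  unfolding gens_eq by blast

lemma unit_in_gens: "src i \<Longrightarrow> snk j \<Longrightarrow> matrix_unit n (Suc i) (Suc j) \<in> gens"
  unfolding gens_eq by blast

text \<open>Apart from the identity and equal factors, both products are 0: a nonzero one would need
  an arrow into a source, an arrow out of a sink, or a common index of the two paths, which
  \<open>p + k + 1 < q\<close> separates.\<close>

lemma gens_commute: "gens \<subseteq> mat_centralizer n gens"
proof -
  have shift_unit: "shift_power n k s (Suc 0) * matrix_unit n (Suc i) (Suc j) = (0\<^sub>m n n :: 'a mat)"
      "matrix_unit n (Suc i) (Suc j) * shift_power n k s (Suc 0) = (0\<^sub>m n n :: 'a mat)"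
    if "s = p \<or> s = q" "src i" "snk j" for s i j
    using that pq qn srcD snkD
    by (intro eq_matI;
        auto simp: index_matrix_unit_mult index_mult_matrix_unit index_shift_power src_def snk_def
          simp del: index_mult_mat(1))+
  have unit_unit: "matrix_unit n (Suc i) (Suc j) * matrix_unit n (Suc i') (Suc j') = (0\<^sub>m n n :: 'a mat)"
    if "src i" "snk j" "src i'" "snk j'" for i j i' j'
    using that pq qn srcD snkD
    by (intro eq_matI) (auto simp: index_matrix_unit_mult matrix_unit_def[of n "Suc i'"]
        src_def snk_def simp del: index_mult_mat(1))
  have shift_shift: "shift_power n k p (Suc 0) * shift_power n k q (Suc 0) = (0\<^sub>m n n :: 'a mat)"
      "shift_power n k q (Suc 0) * shift_power n k p (Suc 0) = (0\<^sub>m n n :: 'a mat)"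
    using pq qn by (intro eq_matI; auto simp: index_shift_mult index_shift_power simp del: index_mult_mat(1))+
  have car: "X \<in> carrier_mat n n" if "X \<in> gens" for X
    using that by (cases rule: gens_cases) auto
  have "X * Y = Y * X" if "X \<in> gens" "Y \<in> gens" for X Y
    using that(1)
  proof (cases rule: gens_cases)
    case one
    then show ?thesis
      using car[OF that(2)] by simp
  next
    case (shift s)
    show ?thesis
      using that(2) shift car[OF that(1)]
      by (cases rule: gens_cases) (auto simp: shift_unit shift_shift)
  next
    case (unit i j)
    show ?thesis
      using that(2) unit car[OF that(1)]
      by (cases rule: gens_cases) (auto simp: shift_unit unit_unit)
  qed
  then show ?thesis
    using car by (auto simp: mat_centralizer_def)
qed

lemma gens_carrier: "gens \<subseteq> carrier_mat n n"
  using gens_commute by (auto simp: mat_centralizer_def)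

lemma is_subalgebra_alg: "is_subalgebra class_ring (module_mat TYPE('a) n n) alg"
  unfolding B_algebra_def by (rule is_subalgebra_generated[OF gens_carrier])

lemma gens_subset_alg: "gens \<subseteq> alg"
  unfolding B_algebra_def generated_subalgebra_def by (rule hull_subset)

lemma alg_subset_centralizer: "alg \<subseteq> mat_centralizer n gens"
  unfolding B_algebra_def generated_subalgebra_def
  by (intro hull_minimal gens_commute is_subalgebra_mat_centralizer gens_carrier)

lemma one_in_alg: "1\<^sub>m n \<in> alg"
  using gens_subset_alg by (auto simp: gens_eq)

section \<open>Supports and entries of matrices that commute with the generators\<close>

lemma interior_cases:
  assumes "r < n"
  shows "src r \<or> snk r \<or> (\<exists>s. (s = p \<or> s = q) \<and> s < r \<and> r \<le> s + k)"
proof -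
  have "src r \<or> snk r \<or> p < r \<and> r \<le> p + k \<or> q < r \<and> r \<le> q + k"
    using assms unfolding src_def snk_def by linarith
  then show ?thesis
    by blast
qed

text \<open>Positions at which a product of \<open>t\<close> elements of the nilpotent ideal of \<open>alg\<close> may be
  nonzero; for \<open>t = 0\<close>, positions of scalars.\<close>

definition supp :: "nat \<Rightarrow> nat \<Rightarrow> nat \<Rightarrow> bool" where
  "supp t r c \<longleftrightarrow> (if t = 0 then r = c else
     (\<exists>s\<in>{p, q}. s \<le> r \<and> c \<le> s + k + 1 \<and> r + t \<le> c) \<or> t = 1 \<and> src r \<and> snk c)"

text \<open>For \<open>t > 0\<close> a jump from source to sink composes with nothing, and the
  blocks of \<open>p\<close> and \<open>q\<close> share no index; so both positions lie in one
  block, where the second gains at least one column.\<close>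

lemma supp_trans: "supp t r j \<Longrightarrow> supp 1 j c \<Longrightarrow> supp (Suc t) r c"
  using pq qn by (cases "t = 0"; auto simp: supp_def src_def snk_def)

text \<open>Inside a block, \<open>s \<le> r\<close> and \<open>c \<le> s + k + 1\<close> leave room
  for at most \<open>k + 1\<close> steps.\<close>

lemma supp_vanishes: "\<not> supp (Suc (k + 1)) r c"
  by (auto simp: supp_def)

text \<open>Commuting with matrix units kills the off-diagonal entries in source columns and sink rows;
  commuting with the shifts makes the rest constant along diagonals.\<close>

context
  fixes X :: "'a mat"
  assumes X: "X \<in> mat_centralizer n gens"
begin

lemma centralizer_carrier: "X \<in> carrier_mat n n"
  using X by (simp add: mat_centralizer_def)

lemma commute_unit:
  assumes "src i" "snk j" "r < n" "c < n"
  shows "(if c = j then X $$ (r, i) else 0) = (if r = i then X $$ (j, c) else 0)"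
proof -
  have "matrix_unit n (Suc i) (Suc j) \<in> gens"
    using assms(1,2) by (rule unit_in_gens)
  then have "X * matrix_unit n (Suc i) (Suc j) = matrix_unit n (Suc i) (Suc j) * X"
    using X by (auto simp: mat_centralizer_def)
  then show ?thesis
    using index_mult_matrix_unit[OF centralizer_carrier, of r c i j]
      index_matrix_unit_mult[OF centralizer_carrier, of r c j i] assms srcD snkD by metis
qed

lemma commute_shift:
  assumes "s = p \<or> s = q" "r < n" "c < n"
  shows "(if s < c \<and> c \<le> s + k + 1 then X $$ (r, c - 1) else 0) =
    (if s \<le> r \<and> r \<le> s + k then X $$ (Suc r, c) else 0)"
proof -
  have "shift_power n k s (Suc 0) \<in> gens"
    using assms(1) by (rule shift_in_gens)
  then have "X * shift_power n k s (Suc 0) = shift_power n k s (Suc 0) * X"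
    using X by (auto simp: mat_centralizer_def)
  moreover have "s + k + 1 < n"
    using assms pq qn by auto
  ultimately show ?thesis
    using index_mult_shift[OF centralizer_carrier, of r c k s]
      index_shift_mult[OF centralizer_carrier, of r c s k] assms by metis
qed

text \<open>A source and a sink that always exist: paired with \<open>n - 1\<close>, every source
  gives a matrix unit that tests its column; paired with \<open>p\<close>, every sink gives one that
  tests its row.\<close>

lemma src_p: "src p" and snk_last: "snk (n - 1)"
  using pq qn by (auto simp: src_def snk_def)

lemma src_column:
  assumes "src i" "r < n" "r \<noteq> i"
  shows "X $$ (r, i) = 0"
  using commute_unit[OF assms(1) snk_last assms(2), of "n - 1"] assms by auto

lemma snk_row:
  assumes "snk j" "c < n" "c \<noteq> j"
  shows "X $$ (j, c) = 0"
  using commute_unit[OF src_p assms(1) srcD[OF src_p] assms(2)] assms by auto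

lemma snk_diag:
  assumes "snk j"
  shows "X $$ (j, j) = X $$ (p, p)"
  using commute_unit[OF src_p assms srcD[OF src_p] snkD[OF assms]] by auto

lemma src_diag:
  assumes "src i"
  shows "X $$ (i, i) = X $$ (p, p)"
  using commute_unit[OF assms snk_last srcD[OF assms] snkD[OF snk_last]] snk_diag[OF snk_last]
  by auto

text \<open>Row \<open>s\<close> determines the diagonals within the block; its entries become the
  coefficients of the shift powers in \<open>centralizer_subset_alg\<close>. The case
  \<open>a = 0\<close> carries the diagonal entry to interior indices.\<close>

lemma toeplitz_upper:
  assumes "s = p \<or> s = q" "i + a \<le> k + 1"
  shows "X $$ (s + i, s + i + a) = X $$ (s, s + a)"
  using assms(2)
proof (induction i)
  case (Suc i)
  have "s + i < n" "s + Suc i + a < n"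
    using assms(1) Suc.prems pq qn by auto
  from commute_shift[OF assms(1) this] Suc show ?case
    by simp
qed simp

text \<open>Carries an entry below the diagonal to column \<open>s\<close>, a source column, where
  \<open>src_column\<close> makes it 0.\<close>

lemma toeplitz_lower:
  assumes "s = p \<or> s = q" "i + a \<le> k + 1"
  shows "X $$ (s + i + a, s + i) = X $$ (s + a, s)"
  using assms(2)
proof (induction i)
  case (Suc i)
  have "s + i + a < n" "s + Suc i < n"
    using assms(1) Suc.prems pq qn by auto
  from commute_shift[OF assms(1) this] Suc show ?case
    by simp
qed simp

lemma centralizer_diag:
  assumes "r < n"
  shows "X $$ (r, r) = X $$ (p, p)"
proof -
  consider "src r" | "snk r" | s where "s = p \<or> s = q" "s \<le> r" "r \<le> s + k"
    using interior_cases[OF assms] by (metis less_imp_le)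
  then show ?thesis
  proof cases
    case 3
    then have "src s"
      by (auto simp: src_def)
    then show ?thesis
      using toeplitz_upper[of s "r - s" 0] src_diag[of s] 3 by simp
  qed (use src_diag snk_diag in blast)+
qed

lemma centralizer_supp:
  assumes "r < n" "c < n" "r \<noteq> c" "X $$ (r, c) \<noteq> 0"
  shows "supp 1 r c"
proof (rule ccontr)
  assume no: "\<not> supp 1 r c"
  have "\<not> src c" "\<not> snk r"
    using src_column[of c r] snk_row[of r c] assms by auto
  \<comment> \<open>For interior \<open>r\<close>, commutation at row \<open>r - 1\<close> equates
    the entry with one of \<open>X\<close> times the shift; that one is 0, since \<open>c\<close> on
    the same path would make the position supported.\<close>
  moreover have "src r" if "snk c"
  proof (rule ccontr)
    assume "\<not> src r"
    then obtain s where s: "s = p \<or> s = q" "s < r" "r \<le> s + k"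
      using \<open>\<not> snk r\<close> interior_cases[OF assms(1)] by blast
    then have "\<not> (s < c \<and> c \<le> s + k + 1)"
      using no that pq by (auto simp: supp_def snk_def)
    moreover have "r - 1 < n" "s \<le> r - 1" "r - 1 \<le> s + k" "Suc (r - 1) = r"
      using s assms(1) by linarith+
    ultimately show False
      using commute_shift[OF s(1) _ assms(2), of "r - 1"] assms(4) by (simp split: if_splits)
  qed
  ultimately have "\<not> snk c"
    using no by (auto simp: supp_def)
  then obtain s where s: "s = p \<or> s = q" "s < c" "c \<le> s + k"
    using \<open>\<not> src c\<close> interior_cases[OF assms(2)] by blast
  show False
  \<comment> \<open>Here \<open>c\<close> is interior to the path from \<open>s\<close>. If
    \<open>r\<close> is off that path, commutation at column \<open>Suc c\<close> gives 0; otherwise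
    the position lies below the diagonal.\<close>
  proof (cases "s \<le> r \<and> r \<le> s + k")
    case False
    moreover have "Suc c < n"
      using s pq qn by linarith
    ultimately show False
      using commute_shift[OF s(1) assms(1), of "Suc c"] s assms by (simp split: if_splits)
  next
    case True
    then have "c < r"
      using no s assms(3) by (auto simp: supp_def)
    then have "X $$ (r, c) = X $$ (s + (r - c), s)"
      using toeplitz_lower[OF s(1), of "c - s" "r - c"] s True by auto
    also have "\<dots> = 0"
      using s True \<open>c < r\<close> assms by (intro src_column) (auto simp: src_def)
    finally show False
      using assms by simp
  qed
qed

end

text \<open>\<open>W\<close> is arbitrary because this serves both \<open>alg\<close> and the
  algebra spanned by the words in the generators without the corner.\<close>

lemma shift_power_in_subalgebra:
  assumes "is_subalgebra class_ring (module_mat TYPE('a) n n) W"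
    and "shift_power n k s (Suc 0) \<in> W" and "s = p \<or> s = q"
  shows "shift_power n k s (Suc a) \<in> W"
proof (induction a)
  case (Suc a)
  have "s + k + 1 < n"
    using assms(3) pq qn by auto
  then show ?case
    using assms(1,2) Suc by (simp add: shift_power_Suc is_subalgebra_mat_iff)
qed (use assms in simp)

lemma centralizer_subset_alg: "mat_centralizer n gens \<subseteq> alg"
proof
  fix X :: "'a mat"
  assume X: "X \<in> mat_centralizer n gens"
  note sub = is_subalgebra_alg[unfolded is_subalgebra_def, THEN conjunct1]
  have add: "x + y \<in> alg" if "x \<in> alg" "y \<in> alg" for x y
    using sub that by (simp add: submodule_mat_iff)
  \<comment> \<open>The exponents stop at \<open>k\<close>: the power \<open>k + 1\<close> is the
    matrix unit at \<open>(s, s + k + 1)\<close>, a position from source to sink, which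
    \<open>block\<close> already counts.\<close>
  define chain where "chain s =
    mat n n (\<lambda>(r, c). \<Sum>a\<in>{1..k}. X $$ (s, s + a) * shift_power n k s a $$ (r, c))" for s
  define block where "block =
    mat n n (\<lambda>(r, c). \<Sum>ij\<in>{i. src i} \<times> {j. snk j}.
      X $$ ij * matrix_unit n (Suc (fst ij)) (Suc (snd ij)) $$ (r, c))"
  have fin: "finite ({i. src i} \<times> {j. snk j})"
    by (intro finite_cartesian_product) (auto intro: finite_subset[of _ "{..<n}"] srcD snkD)
  have power: "shift_power n k s a \<in> alg" if s: "s = p \<or> s = q" and a: "a \<in> {1..k}" for s a
  proof -
    obtain b where "a = Suc b"
      using a by (cases a) auto
    then show ?thesis
      using shift_power_in_subalgebra[OF is_subalgebra_alg subsetD[OF gens_subset_alg] s]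
        shift_in_gens[OF s] by blast
  qed
  have chain_alg: "chain s \<in> alg" if "s = p \<or> s = q" for s
    unfolding chain_def by (intro submodule_mat_lincomb[OF sub] power[OF that]) simp_all
  have block_alg: "block \<in> alg"
    unfolding block_def
    by (intro submodule_mat_lincomb[OF sub fin] subsetD[OF gens_subset_alg] unit_in_gens) auto
  have chain_index: "chain s $$ (r, c) =
      (if s \<le> r \<and> r < c \<and> c \<le> s + k + 1 \<and> c \<le> r + k then X $$ (s, s + (c - r)) else 0)"
    if "r < n" "c < n" for s r c
  proof -
    have "chain s $$ (r, c) = (\<Sum>a\<in>{1..k}. X $$ (s, s + a) * shift_power n k s a $$ (r, c))"
      using that by (simp add: chain_def)
    also have "\<dots> = (\<Sum>a\<in>{1..k}. if a = c - r then
        (if s \<le> r \<and> r < c \<and> c \<le> s + k + 1 then X $$ (s, s + (c - r)) else 0) else 0)"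
      using that by (intro sum.cong) (auto simp: index_shift_power)
    also have "\<dots> = (if s \<le> r \<and> r < c \<and> c \<le> s + k + 1 \<and> c \<le> r + k
        then X $$ (s, s + (c - r)) else 0)"
      by (subst sum.delta) auto
    finally show ?thesis .
  qed
  have block_index: "block $$ (r, c) = (if src r \<and> snk c then X $$ (r, c) else 0)"
    if "r < n" "c < n" for r c
  proof -
    have "block $$ (r, c) = (\<Sum>ij\<in>{i. src i} \<times> {j. snk j}.
        X $$ ij * matrix_unit n (Suc (fst ij)) (Suc (snd ij)) $$ (r, c))"
      using that by (simp add: block_def)
    also have "\<dots> = (\<Sum>ij\<in>{i. src i} \<times> {j. snk j}. if ij = (r, c) then X $$ (r, c) else 0)"
      using that by (intro sum.cong) (auto simp: matrix_unit_def)
    also have "\<dots> = (if src r \<and> snk c then X $$ (r, c) else 0)"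
      using fin by (subst sum.delta) auto
    finally show ?thesis .
  qed
  have entry: "X $$ (r, c) = X $$ (p, p) * (if r = c then 1 else 0) +
      chain p $$ (r, c) + chain q $$ (r, c) + block $$ (r, c)" if rc: "r < n" "c < n" for r c
  proof -
    have "\<exists>s. (s = p \<or> s = q) \<and> s \<le> r \<and> c \<le> s + k + 1 \<and> r < c"
      if "supp 1 r c" "\<not> (src r \<and> snk c)"
      using that by (auto simp: supp_def Suc_le_eq)
    then consider (diag) "r = c" | (block) "r \<noteq> c" "src r" "snk c"
      | (chain) s where "\<not> (src r \<and> snk c)" "s = p \<or> s = q" "s \<le> r" "c \<le> s + k + 1" "r < c"
      | (zero) "r \<noteq> c" "\<not> supp 1 r c"
      by blast
    then show ?thesis
    proof cases
      case diag
      then have "\<not> (src r \<and> snk c)"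
        using pq by (auto simp: src_def snk_def)
      then show ?thesis
        using diag rc centralizer_diag[OF X rc(1)] by (auto simp: chain_index block_index)
    next
      case block
      then have "\<not> (s \<le> r \<and> r < c \<and> c \<le> s + k + 1 \<and> c \<le> r + k)" if "s = p \<or> s = q" for s
        using that pq by (auto simp: src_def snk_def)
      then have "chain s $$ (r, c) = 0" if "s = p \<or> s = q" for s
        unfolding chain_index[OF rc] using that by (simp only: if_False)
      then show ?thesis
        using block by (simp add: block_index[OF rc])
    next
      case chain
      \<comment> \<open>Within the block only \<open>(s, s + k + 1)\<close> is \<open>k + 1\<close>
        steps apart, and it belongs to the excluded positions from source to sink.\<close>
      have "c \<le> r + k"
      proof (rule ccontr)
        assume "\<not> c \<le> r + k"
        then have "r = s" "c = s + k + 1"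
          using chain by auto
        then show False
          using chain(1,2) pq qn by (auto simp: src_def snk_def)
      qed
      moreover have "X $$ (r, c) = X $$ (s, s + (c - r))"
        using toeplitz_upper[OF X chain(2), of "r - s" "c - r"] chain by simp
      ultimately have "chain s $$ (r, c) = X $$ (r, c)"
        using chain by (simp add: chain_index[OF rc])
      moreover have "chain s' $$ (r, c) = 0" if "s' = p \<or> s' = q" "s' \<noteq> s" for s'
        using that chain pq by (auto simp: chain_index[OF rc])
      moreover have "block $$ (r, c) = 0"
        using chain(1) by (auto simp: block_index[OF rc])
      ultimately show ?thesis
        using chain(2,5) pq by auto
    next
      case zero
      then have "\<not> (s \<le> r \<and> r < c \<and> c \<le> s + k + 1)" if "s = p \<or> s = q" for s
        using that by (auto simp: supp_def)
      then have "chain s $$ (r, c) = 0" if "s = p \<or> s = q" for s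
        unfolding chain_index[OF rc] using that by auto
      moreover have "\<not> (src r \<and> snk c)"
        using zero by (auto simp: supp_def)
      moreover have "X $$ (r, c) = 0"
        using centralizer_supp[OF X rc] zero by blast
      ultimately show ?thesis
        using zero by (simp add: block_index[OF rc])
    qed
  qed
  have dims: "chain s \<in> carrier_mat n n" "block \<in> carrier_mat n n"
      "dim_row (chain s) = n" "dim_col (chain s) = n" "dim_row block = n" "dim_col block = n" for s
    by (simp_all add: chain_def block_def)
  have "X = X $$ (p, p) \<cdot>\<^sub>m 1\<^sub>m n + chain p + chain q + block" (is "_ = ?Y")
  proof (rule eq_matI)
    fix r c assume "r < dim_row ?Y" "c < dim_col ?Y"
    then have rc: "r < n" "c < n"
      using dims by auto
    have "?Y $$ (r, c) = X $$ (p, p) * (if r = c then 1 else 0) +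
        chain p $$ (r, c) + chain q $$ (r, c) + block $$ (r, c)"
      using rc dims by simp
    then show "X $$ (r, c) = ?Y $$ (r, c)"
      using entry[OF rc] by simp
  qed (use dims centralizer_carrier[OF X] in auto)
  moreover have "X $$ (p, p) \<cdot>\<^sub>m 1\<^sub>m n \<in> alg"
    using sub one_in_alg by (simp add: submodule_mat_iff)
  then have "?Y \<in> alg"
    using chain_alg block_alg by (intro add) auto
  ultimately show "X \<in> alg"
    by simp
qed

lemma maximal_commutative_alg:
  "maximal_commutative_subalgebra class_ring (module_mat TYPE('a) n n) alg"
  using maximal_commutative_subalgebraI[OF gens_commute] centralizer_subset_alg
  by (simp add: B_algebra_def)

section \<open>Upper bound for the length\<close>

lemma alg_carrier: "alg \<subseteq> carrier_mat n n"
  using is_subalgebra_alg by (simp add: is_subalgebra_mat_iff)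

lemma word_span_alg_bounded:
  assumes "S \<subseteq> alg"
  shows "mat_word_span n S i \<subseteq> mat_word_span n S (k + 1)"
proof -
  \<comment> \<open>Only supports are recorded, not membership in a power of the ideal;
    \<open>D 0\<close> thus holds all diagonal matrices.\<close>
  define D :: "nat \<Rightarrow> 'a mat set" where
    "D t = {Y \<in> carrier_mat n n. \<forall>r<n. \<forall>c<n. Y $$ (r, c) \<noteq> 0 \<longrightarrow> supp t r c}" for t
  show ?thesis
  proof (rule word_span_bounded_by_filtration[of S n D])
    show "S \<subseteq> carrier_mat n n"
      using assms alg_carrier by blast
    show "1\<^sub>m n \<in> D 0"
      by (auto simp: D_def supp_def)
    show "D t \<subseteq> carrier_mat n n" for t
      by (auto simp: D_def)
    show "D (Suc (k + 1)) \<subseteq> {0\<^sub>m n n}"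
      using supp_vanishes by (auto simp: D_def)
    fix X assume "X \<in> S"
    then have X: "X \<in> mat_centralizer n gens"
      using assms alg_subset_centralizer by blast
    \<comment> \<open>By \<open>centralizer_diag\<close> the whole diagonal of \<open>X\<close>
      equals this scalar, so \<open>?N\<close> lives on the positions of
      \<open>supp 1\<close>.\<close>
    let ?N = "X - X $$ (p, p) \<cdot>\<^sub>m 1\<^sub>m n"
    have N: "?N \<in> carrier_mat n n"
      by (intro minus_carrier_mat) simp
    have "Y * ?N \<in> D (Suc t)" if Y: "Y \<in> D t" for t Y
    proof -
      have Yc: "Y \<in> carrier_mat n n"
        using Y by (simp add: D_def)
      have "supp (Suc t) r c" if rc: "r < n" "c < n" "(Y * ?N) $$ (r, c) \<noteq> 0" for r c
      proof -
        have "(Y * ?N) $$ (r, c) = (\<Sum>j = 0..<n. Y $$ (r, j) * ?N $$ (j, c))"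
          using rc N Yc by (simp add: scalar_prod_def)
        then obtain j where j: "j < n" "Y $$ (r, j) \<noteq> 0" "?N $$ (j, c) \<noteq> 0"
          using rc(3) by (metis (no_types, lifting) atLeastLessThan_iff mult_not_zero sum.neutral)
        moreover have "?N $$ (j, c) = X $$ (j, c) - X $$ (p, p) * (if j = c then 1 else 0)"
          using j(1) rc(2) centralizer_carrier[OF X] by simp
        ultimately have "j \<noteq> c" "X $$ (j, c) \<noteq> 0"
          using centralizer_diag[OF X j(1)] by (auto split: if_splits)
        then have "supp 1 j c"
          using centralizer_supp[OF X j(1) rc(2)] by blast
        moreover have "supp t r j"
          using Y j rc by (simp add: D_def)
        ultimately show ?thesis
          by (rule supp_trans[rotated])
      qed
      then show ?thesis
        using N Yc by (simp add: D_def)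
    qed
    then show "\<exists>x. \<forall>t. \<forall>Y\<in>D t. Y * (X - x \<cdot>\<^sub>m 1\<^sub>m n) \<in> D (Suc t)"
      by blast
  qed
qed

abbreviation alg_record :: "('a, 'a mat) module" where
  "alg_record \<equiv> (module_mat TYPE('a) n n)\<lparr>carrier := alg\<rparr>"

lemma word_span_alg:
  "S \<subseteq> alg \<Longrightarrow> word_span class_ring alg_record S i = mat_word_span n S i"
  by (rule word_span_subalgebra[OF is_subalgebra_alg one_in_alg])

lemma generating_system_alg_iff:
  "generating_system class_ring alg_record S \<longleftrightarrow>
     finite S \<and> S \<subseteq> alg \<and> mat_word_span n S (k + 1) = alg"
proof -
  have "(\<Union>i. mat_word_span n S i) = mat_word_span n S (k + 1)" if "S \<subseteq> alg"
    using word_span_alg_bounded[OF that] by blast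
  then show ?thesis
    by (cases "S \<subseteq> alg") (simp_all add: generating_system_def word_span_alg)
qed

lemma system_length_le:
  "generating_system class_ring alg_record S \<Longrightarrow> system_length class_ring alg_record S \<le> k + 1"
  unfolding system_length_def generating_system_alg_iff
  by (intro Least_le) (simp add: word_span_alg)

section \<open>A generating system of length k + 1\<close>

text \<open>Without the corner unit, every generator moves a path from row \<open>m\<close> to column \<open>m + k + 1\<close>
  by at most one step.\<close>

abbreviation corner :: "'a mat" where
  "corner \<equiv> matrix_unit n (Suc p) (Suc (p + k + 1))"

lemma corner_eq: "corner = shift_power n k p (Suc k)"
  using pq qn by (intro eq_matI) (auto simp: index_shift_power matrix_unit_def)

lemma corner_index: "corner $$ (r, c) = (if r = p \<and> c = p + k + 1 then 1 else 0)"
  if "r < n" "c < n"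
  using that by (auto simp: matrix_unit_def)

lemma corner_in_gens: "corner \<in> gens"
proof -
  have "src p" "snk (p + k + 1)"
    using pq by (auto simp: src_def snk_def)
  then show ?thesis
    by (rule unit_in_gens)
qed

lemma finite_gens: "finite gens"
proof -
  have "finite {i. src i}" "finite {j. snk j}"
    by (auto intro: finite_subset[of _ "{..<n}"] srcD snkD)
  then show ?thesis
    unfolding gens_eq by (simp add: finite_image_set2)
qed

lemma generating_gens_minus_corner:
  "generating_system class_ring alg_record (gens - {corner})"
proof -
  let ?S = "gens - {corner}"
  let ?W = "\<Union>i. mat_word_span n ?S i"
  have S: "?S \<subseteq> alg" "?S \<subseteq> carrier_mat n n"
    using gens_subset_alg gens_carrier by auto
  have W: "is_subalgebra class_ring (module_mat TYPE('a) n n) ?W"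
    by (rule is_subalgebra_Union_word_span[OF S(2)])
  have SW: "?S \<subseteq> ?W"
    using generator_in_mat_word_span[OF S(2)] by blast
  \<comment> \<open>For \<open>k = 0\<close> this shift would be the corner itself;
    \<open>k_pos\<close> ensures that it survives the removal.\<close>
  have "shift_power n k p (Suc 0) $$ (p, Suc p) \<noteq> corner $$ (p, Suc p)"
    using pq qn k_pos by (simp add: index_shift_power matrix_unit_def)
  then have "shift_power n k p (Suc 0) \<in> ?S"
    using shift_in_gens[of p] by force
  then have "Y \<in> ?W" if "Y = shift_power n k p (Suc k)" for Y
    unfolding that by (intro shift_power_in_subalgebra[OF W subsetD[OF SW]]) simp_all
  from this[OF corner_eq] have "gens \<subseteq> ?W"
    using SW by blast
  then have "alg \<subseteq> ?W"
    unfolding B_algebra_def generated_subalgebra_def by (intro hull_minimal W)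
  moreover have "mat_word_span n ?S i \<subseteq> alg" for i
    using is_subalgebra_alg foldr_mult_mat_closed[OF is_subalgebra_alg one_in_alg] S(1)
    by (intro mat_word_span_minimal) (auto simp: is_subalgebra_def)
  ultimately show ?thesis
    using finite_gens S(1) word_span_alg_bounded[OF S(1)]
    unfolding generating_system_alg_iff by blast
qed

lemma corner_notin_word_span:
  "corner \<notin> mat_word_span n (gens - {corner}) k"
proof -
  let ?S = "gens - {corner}" and ?z = "p + k + 1"
  \<comment> \<open>\<open>Q t\<close> describes column \<open>?z\<close> of a word with
    \<open>t\<close> letters: from row \<open>r\<close> the end \<open>?z\<close> is more than
    \<open>t\<close> steps away, and other sinks never reach it. The bound \<open>p \<le> r\<close>
    is there because rows above \<open>p\<close> still jump to \<open>?z\<close> by their own matrix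
    units; row \<open>q\<close> lies beyond \<open>?z\<close>.\<close>
  define Q where "Q t Y \<longleftrightarrow> (\<forall>r. p \<le> r \<and> r + t < ?z \<longrightarrow> Y $$ (r, ?z) = 0) \<and>
    (\<forall>j. snk j \<and> j \<noteq> ?z \<longrightarrow> Y $$ (j, ?z) = 0)" for t and Y :: "'a mat"
  have zn: "?z < n"
    using pq qn by simp
  have step: "Q (Suc t) (X * Y)" if X: "X \<in> ?S" and Y: "Y \<in> carrier_mat n n" "Q t Y" for X Y t
  proof -
    from X have "X \<in> gens"
      by simp
    then show ?thesis
    proof (cases rule: gens_cases)
      case one
      then show ?thesis
        using Y by (simp add: Q_def)
    next
      case (shift s)
      then have s: "s + k + 1 < n"
        using pq qn by auto
      show ?thesis
        unfolding Q_def
      proof (intro conjI allI impI)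
        fix r assume r: "p \<le> r \<and> r + Suc t < ?z"
        then have "r < n"
          using zn by simp
        moreover have "Y $$ (Suc r, ?z) = 0"
          using Y(2) r by (simp add: Q_def)
        ultimately show "(X * Y) $$ (r, ?z) = 0"
          using index_shift_mult[OF Y(1) _ zn s] shift(2) by simp
      next
        fix j assume j: "snk j \<and> j \<noteq> ?z"
        then have "\<not> (s \<le> j \<and> j \<le> s + k)"
          using shift(1) pq by (auto simp: snk_def)
        then show "(X * Y) $$ (j, ?z) = 0"
          using index_shift_mult[OF Y(1) _ zn s] shift(2) j snkD by auto
      qed
    next
      case (unit i j)
      have XY: "(X * Y) $$ (r, ?z) = (if r = i then Y $$ (j, ?z) else 0)" if "r < n" for r
        using index_matrix_unit_mult[OF Y(1) that zn snkD[OF unit(2)]] unit(3) by simp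
      show ?thesis
        unfolding Q_def
      proof (intro conjI allI impI)
        fix r assume r: "p \<le> r \<and> r + Suc t < ?z"
        have "r = i \<Longrightarrow> i = p"
          using r unit(1) pq by (auto simp: src_def)
        \<comment> \<open>The unit at \<open>(p, ?z)\<close> is the removed corner, so row
          \<open>p\<close> of the product reads another sink row, which the second clause of
          \<open>Q\<close> makes 0.\<close>
        then have "r = i \<Longrightarrow> j \<noteq> ?z"
          using unit(3) X by auto
        then show "(X * Y) $$ (r, ?z) = 0"
          using XY[of r] Y(2) unit(2) r zn by (auto simp: Q_def)
      next
        fix j' assume j': "snk j' \<and> j' \<noteq> ?z"
        then have "j' \<noteq> i"
          using unit(1) pq by (auto simp: src_def snk_def)
        then show "(X * Y) $$ (j', ?z) = 0"
          using XY[of j'] j' snkD by simp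
      qed
    qed
  qed
  have word: "Q (length ws) (foldr (*) ws (1\<^sub>m n))" if "set ws \<subseteq> ?S" for ws
    using that
  proof (induction ws)
    case Nil
    then show ?case
      using zn snkD by (auto simp: Q_def)
  next
    case (Cons X ws)
    have "set ws \<subseteq> carrier_mat n n"
      using Cons.prems gens_carrier by auto
    then show ?case
      using Cons step[OF _ foldr_mult_mat_carrier] by simp
  qed
  let ?W = "{Y \<in> carrier_mat n n. Y $$ (p, ?z) = (0 :: 'a)}"
  have "mat_word_span n ?S k \<subseteq> ?W"
  proof (rule mat_word_span_minimal)
    show "submodule class_ring ?W (module_mat TYPE('a) n n)"
      using zn by (auto simp: submodule_mat_iff)
    fix ws assume ws: "set ws \<subseteq> ?S" "length ws \<le> k"
    have "set ws \<subseteq> carrier_mat n n"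
      using ws(1) gens_carrier by auto
    then show "foldr (*) ws (1\<^sub>m n) \<in> ?W"
      using word[OF ws(1)] ws(2) foldr_mult_mat_carrier[of ws n] by (simp add: Q_def)
  qed
  moreover have "corner $$ (p, ?z) = 1"
    using corner_index zn by simp
  ultimately show ?thesis
    by auto
qed

lemma system_length_gens_minus_corner:
  "system_length class_ring alg_record (gens - {corner}) = k + 1"
proof -
  let ?S = "gens - {corner}"
  have S: "?S \<subseteq> alg" "?S \<subseteq> carrier_mat n n" "corner \<in> alg"
    using gens_subset_alg gens_carrier corner_in_gens by auto
  show ?thesis
    unfolding system_length_def
  proof (rule Least_equality)
    show "word_span class_ring alg_record ?S (k + 1) = carrier alg_record"
      using generating_gens_minus_corner by (simp add: generating_system_alg_iff word_span_alg)
    fix r assume "word_span class_ring alg_record ?S r = carrier alg_record"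
    then have "corner \<in> mat_word_span n ?S r"
      using S by (simp add: word_span_alg)
    then show "k + 1 \<le> r"
      using mat_word_span_mono[OF S(2), of r k] corner_notin_word_span by fastforce
  qed
qed

lemma algebra_length_alg: "algebra_length class_ring alg_record = k + 1"
proof -
  let ?T = "{system_length class_ring alg_record S | S. generating_system class_ring alg_record S}"
  have le: "t \<le> k + 1" if "t \<in> ?T" for t
    using that system_length_le by blast
  \<comment> \<open>There may be infinitely many generating systems; the bound on their lengths is
    what makes \<open>Max\<close> meaningful.\<close>
  moreover have "finite ?T"
    by (rule finite_subset[of _ "{..k + 1}"]) (use le in blast)+
  moreover have "k + 1 \<in> ?T"
    using generating_gens_minus_corner system_length_gens_minus_corner[symmetric] by blast
  ultimately show ?thesis
    unfolding algebra_length_def by (intro Max_eqI)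
qed

end

theorem theoremA:
  fixes n m l k :: nat
  assumes "n > 0" and "m > 0" and "l > 0" and "k > 0"
    and "l > m + k + 1"
    and "l + k + 1 \<le> n"
  shows "maximal_commutative_subalgebra class_ring (module_mat TYPE('a::field) n n)
           (B_algebra n k m l) \<and>
         algebra_length class_ring
           ((module_mat TYPE('a) n n)\<lparr>carrier := B_algebra n k m l\<rparr>) = k + 1"
proof -
  obtain p q where m: "m = Suc p" and l: "l = Suc q"
    using assms(2,3) by (metis gr0_implies_Suc)
  interpret two_shifts n k p q "TYPE('a)"
    using assms m l by unfold_locales auto
  show ?thesis
    unfolding m l using maximal_commutative_alg algebra_length_alg by blast
qed

end
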